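(* The capacity $\mathsf{C}_{\mathrm E}(\mathbf{h},\boldsymbol{\alpha},\sigma)$ can be equivalently expressed as $$\mathsf{C}_{\mathrm E}(\mathbf{h},\boldsymbol{\alpha},\sigma)=\sup_{\mathscr{P}_S} I(S;S+Z),$$ where the supremum is over all probability laws $\mathscr{P}_S$ of a random variable $S$ (independent of $Z$) with $\mathsf{supp}\,S\subseteq[0,1]$ satisfying $$\mathbb{E}[S]=\mathbf{h}^{\mathsf T}\boldsymbol{\alpha},\qquad \mathbb{E}\big[(S-\mathsf{H}_{[k]})_+\big]\le(1-\mathsf{H}_{[k]})\bar\alpha_k\quad\text{for all }k\in\{1,\dots,n-1\}.$$
   Context: Let $n\ge 2$ be an integer, $\mathbf{h}=(h_1,\dots,h_n)^{\mathsf T}$ with $h_k>0$ and $\sum_{k=1}^n h_k=1$, and $\boldsymbol{\alpha}=(\alpha_1,\dots,\alpha_n)^{\mathsf T}$ with $1\ge\alpha_1>\alpha_2>\cdots>\alpha_n>0$ and $\alpha_n\le \tfrac12$. Put $\mathsf{H}_{[k]}=\sum_{i=1}^k h_i$ and $\bar\alpha_k=\frac{\sum_{i=k+1}^n h_i\alpha_i}{1-\mathsf{H}_{[k]}}$ for $0\le k\le n-1$ ($\mathsf{H}_{[0]}=0$), and $(a)_+=\max\{a,0\}$. Channel: $Y=\mathbf{h}^{\mathsf T}\mathbf{X}+Z$ with $Z\sim\mathcal{N}(0,\sigma^2)$, $\sigma>0$, independent of $\mathbf{X}=(X_1,\dots,X_n)^{\mathsf T}$. The EC-OIC capacity is $\mathsf{C}_{\mathrm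 E}(\mathbf{h},\boldsymbol{\alpha},\sigma)=\sup I(\mathbf{X};Y)$, the supremum being over all laws of $\mathbf{X}$ with $0\le X_k\le1$ (almost surely) and $\mathbb{E}[X_k]=\alpha_k$ for all $k\in\{1,\dots,n\}$. $I(\cdot;\cdot)$ denotes mutual information. *)

theory Defs
  imports "HOL-Probability.Probability"
begin

text \<open>The topological support of a Borel measure: the points all of whose open
  neighbourhoods are charged.\<close>

definition measure_support :: "'a::topological_space measure \<Rightarrow> 'a set" where
  "measure_support P = {x. \<forall>U. open U \<longrightarrow> x \<in> U \<longrightarrow> emeasure P U > 0}"

definition gaussian_noise :: "real \<Rightarrow> real measure" where
  "gaussian_noise \<sigma> = density lborel (\<lambda>z. ennreal (normal_density 0 \<sigma> z))"

text \<open>\<open>gaussian_channel_information b \<sigma> f P\<close> is \<open>I(W; f(W) + Z)\<close> for an input \<open>W\<close> with law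
  \<open>P\<close> and a centred Gaussian \<open>Z\<close> of standard deviation \<open>\<sigma>\<close>, independent of \<open>W\<close> because the
  underlying probability space is the product. The unit of information is set by the base
  \<open>b\<close> of the logarithm.\<close>

definition gaussian_channel_information ::
    "real \<Rightarrow> real \<Rightarrow> ('a \<Rightarrow> real) \<Rightarrow> 'a measure \<Rightarrow> real" where
  "gaussian_channel_information b \<sigma> f P =
     prob_space.mutual_information (P \<Otimes>\<^sub>M gaussian_noise \<sigma>) b P borel
       fst (\<lambda>(w, z). f w + z)"

text \<open>Vectors in \<open>\<real>\<^sup>n\<close> are functions on \<open>{1..n}\<close>, because the constraints depend on the
  order of the indices.\<close>

definition EC_input_laws :: "nat \<Rightarrow> (nat \<Rightarrow> real) \<Rightarrow> (nat \<Rightarrow> real) measure set" where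
  "EC_input_laws n \<alpha> =
     {P. prob_space P \<and> sets P = sets (PiM {1..n} (\<lambda>_. borel)) \<and>
         (AE x in P. \<forall>k\<in>{1..n}. 0 \<le> x k \<and> x k \<le> 1) \<and>
         (\<forall>k\<in>{1..n}. (\<integral>x. x k \<partial>P) = \<alpha> k)}"

definition EC_capacity ::
    "real \<Rightarrow> nat \<Rightarrow> (nat \<Rightarrow> real) \<Rightarrow> (nat \<Rightarrow> real) \<Rightarrow> real \<Rightarrow> ereal" where
  "EC_capacity b n h \<alpha> \<sigma> =
     (SUP P\<in>EC_input_laws n \<alpha>.
        ereal (gaussian_channel_information b \<sigma> (\<lambda>x. \<Sum>k=1..n. h k * x k) P))"

definition gain_sum :: "(nat \<Rightarrow> real) \<Rightarrow> nat \<Rightarrow> real" where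
  "gain_sum h k = (\<Sum>i=1..k. h i)"

definition tail_mean :: "nat \<Rightarrow> (nat \<Rightarrow> real) \<Rightarrow> (nat \<Rightarrow> real) \<Rightarrow> nat \<Rightarrow> real" where
  "tail_mean n h \<alpha> k = (\<Sum>i=k+1..n. h i * \<alpha> i) / (1 - gain_sum h k)"

end

theory Submission
  imports Defs
begin

text \<open>The information \<open>I(X; h\<^sup>T X + Z)\<close> depends on \<open>X\<close> only through the law of \<open>S = h\<^sup>T X\<close>, so both
  suprema agree once the laws of \<open>S\<close> arising from admissible inputs are identified. The
  constraints are necessary because \<open>(S - H\<^sub>k)\<^sub>+ \<le> \<Sum>\<^sub>i\<^sub>>\<^sub>k h\<^sub>i X\<^sub>i\<close> pointwise. Conversely, filling the
  coordinates one after the other up to the level \<open>S\<close> gives deterministic profiles \<open>\<phi>\<^sub>k\<close> with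
  \<open>\<Sum>\<^sub>i\<^sub>>\<^sub>k h\<^sub>i \<phi>\<^sub>i(S) = (S - H\<^sub>k)\<^sub>+\<close>, and the constraints say that their means majorize \<open>\<alpha>\<close> in the
  \<open>h\<close>-weighted sense. Finitely many pairwise averagings of profiles, which keep the values in
  \<open>[0,1]\<close> and the weighted sum equal to \<open>S\<close>, then bring the means down to \<open>\<alpha>\<close>.\<close>

section \<open>Mutual information of the Gaussian channel in terms of the law of the signal\<close>

lemma prob_space_gaussian_noise:
  assumes "\<sigma> > 0"
  shows "prob_space (gaussian_noise \<sigma>)"
  unfolding gaussian_noise_def using assms by (rule prob_space_normal_density)

lemma sets_gaussian_noise [simp, measurable_cong]: "sets (gaussian_noise \<sigma>) = sets borel"
  by (simp add: gaussian_noise_def)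

lemma nn_integral_gaussian_noise_shift:
  assumes [measurable]: "u \<in> borel_measurable borel"
  shows "(\<integral>\<^sup>+z. u (c + z) \<partial>gaussian_noise \<sigma>)
    = (\<integral>\<^sup>+y. ennreal (normal_density 0 \<sigma> (y - c)) * u y \<partial>lborel)"
proof -
  have "(\<integral>\<^sup>+z. u (c + z) \<partial>gaussian_noise \<sigma>)
      = (\<integral>\<^sup>+z. ennreal (normal_density 0 \<sigma> z) * u (c + z) \<partial>lborel)"
    unfolding gaussian_noise_def by (subst nn_integral_density) auto
  also have "\<dots> = (\<integral>\<^sup>+y. ennreal (normal_density 0 \<sigma> (y - c)) * u y \<partial>lborel)"
    by (subst (2) nn_integral_real_affine[where c=1 and t=c]) auto
  finally show ?thesis .
qed

text \<open>Given the input \<open>w\<close>, the output is Gaussian with centre \<open>f w\<close>;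
  by Tonelli this conditional density is the joint density. With \<open>P\<close> itself as
  reference measure on the input side, discrete and singular inputs are covered.\<close>

lemma distributed_gaussian_channel:
  fixes f :: "'a \<Rightarrow> real"
  assumes "prob_space P" and [measurable]: "f \<in> borel_measurable P" and "\<sigma> > 0"
  shows "distributed (P \<Otimes>\<^sub>M gaussian_noise \<sigma>) (P \<Otimes>\<^sub>M lborel)
    (\<lambda>x. (fst x, case x of (w, z) \<Rightarrow> f w + z)) (\<lambda>(w, y). normal_density 0 \<sigma> (y - f w))"
proof -
  interpret P: prob_space P by fact
  interpret N: prob_space "gaussian_noise \<sigma>" using \<open>\<sigma> > 0\<close> by (rule prob_space_gaussian_noise)
  have "distr (P \<Otimes>\<^sub>M gaussian_noise \<sigma>) (P \<Otimes>\<^sub>M lborel)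
        (\<lambda>x. (fst x, case x of (w, z) \<Rightarrow> f w + z))
      = density (P \<Otimes>\<^sub>M lborel) (\<lambda>(w, y). ennreal (normal_density 0 \<sigma> (y - f w)))"
    (is "?L = ?R")
  proof (rule measure_eqI)
    fix A assume "A \<in> sets ?L"
    then have A[measurable]: "A \<in> sets (P \<Otimes>\<^sub>M lborel)" by simp
    have "emeasure ?L A
        = (\<integral>\<^sup>+x. indicator A (fst x, f (fst x) + snd x) \<partial>(P \<Otimes>\<^sub>M gaussian_noise \<sigma>))"
    proof -
      have "emeasure ?L A = (\<integral>\<^sup>+x. indicator A x \<partial>?L)" using A by simp
      also have "\<dots> = (\<integral>\<^sup>+x. indicator A (fst x, f (fst x) + snd x) \<partial>(P \<Otimes>\<^sub>M gaussian_noise \<sigma>))"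
        by (subst nn_integral_distr) (auto simp: case_prod_unfold)
      finally show ?thesis .
    qed
    also have "\<dots> = (\<integral>\<^sup>+w. \<integral>\<^sup>+z. indicator A (w, f w + z) \<partial>gaussian_noise \<sigma> \<partial>P)"
      by (subst N.nn_integral_fst[symmetric]) auto
    also have "\<dots> = (\<integral>\<^sup>+w. \<integral>\<^sup>+y. ennreal (normal_density 0 \<sigma> (y - f w)) * indicator A (w, y) \<partial>lborel \<partial>P)"
    proof (rule nn_integral_cong)
      fix w assume w: "w \<in> space P"
      show "(\<integral>\<^sup>+z. indicator A (w, f w + z) \<partial>gaussian_noise \<sigma>)
        = (\<integral>\<^sup>+y. ennreal (normal_density 0 \<sigma> (y - f w)) * indicator A (w, y) \<partial>lborel)"
        by (rule nn_integral_gaussian_noise_shift) (use w in measurable)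
    qed
    also have "\<dots> = emeasure ?R A"
      using A by (subst emeasure_density)
        (auto simp: lborel.nn_integral_fst[symmetric] case_prod_unfold)
    finally show "emeasure ?L A = emeasure ?R A" .
  qed simp
  then show ?thesis
    by (auto simp: distributed_def case_prod_unfold)
qed

text \<open>Density formula for mutual information, with \<open>q\<close> the output density. The
  integrand involves \<open>w\<close> only through \<open>f w\<close>, so \<open>P\<close> can later
  be replaced by its image under \<open>f\<close>.\<close>

lemma gaussian_channel_information_eq_integral:
  fixes f :: "'a \<Rightarrow> real"
  assumes "prob_space P" and f[measurable]: "f \<in> borel_measurable P" and "\<sigma> > 0" and "b > 1"
  defines "q \<equiv> \<lambda>y. \<integral>w. normal_density 0 \<sigma> (y - f w) \<partial>P"
  shows "gaussian_channel_information b \<sigma> f P =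
    (\<integral>(w, y). normal_density 0 \<sigma> (y - f w) * log b (normal_density 0 \<sigma> (y - f w) / q y)
      \<partial>(P \<Otimes>\<^sub>M lborel))"
proof -
  let ?M = "P \<Otimes>\<^sub>M gaussian_noise \<sigma>"
  interpret P: prob_space P by fact
  interpret N: prob_space "gaussian_noise \<sigma>" using \<open>\<sigma> > 0\<close> by (rule prob_space_gaussian_noise)
  interpret PN: pair_prob_space P "gaussian_noise \<sigma>" ..
  interpret M: information_space ?M b by standard (rule \<open>b > 1\<close>)
  note joint = distributed_gaussian_channel[OF \<open>prob_space P\<close> f \<open>\<sigma> > 0\<close>]
  \<comment> \<open>Relative to its own law the input has constant density 1.\<close>
  have X: "distributed ?M P fst (\<lambda>_. ennreal 1)"
    using N.distr_pair_fst[of P] P.prob_space_axioms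
    by (auto simp: distributed_def density_1)
  have "distributed ?M lborel (\<lambda>(w, z). f w + z) (\<lambda>y. \<integral>\<^sup>+w. normal_density 0 \<sigma> (y - f w) \<partial>P)"
    using PN.P.distr_marginal2[OF P.sigma_finite_measure_axioms lborel.sigma_finite_measure_axioms joint]
    by simp
  \<comment> \<open>The Gaussian density is bounded, hence integrable under the probability
    \<open>P\<close>, so the mixture is finite for every \<open>y\<close>.\<close>
  moreover have "(\<integral>\<^sup>+w. normal_density 0 \<sigma> (y - f w) \<partial>P) = ennreal (q y)" for y
    unfolding q_def
  proof (rule nn_integral_eq_integral)
    have "normal_density 0 \<sigma> t \<le> 1 / sqrt (2 * pi * \<sigma>\<^sup>2)" for t
      using \<open>\<sigma> > 0\<close> by (auto simp: normal_density_def divide_right_mono)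
    then show "integrable P (\<lambda>w. normal_density 0 \<sigma> (y - f w))"
      by (intro P.integrable_const_bound[where B = "1 / sqrt (2 * pi * \<sigma>\<^sup>2)"]) auto
  qed auto
  ultimately have Y: "distributed ?M lborel (\<lambda>(w, z). f w + z) (\<lambda>y. ennreal (q y))"
    by simp
  \<comment> \<open>The definition uses \<open>borel\<close> on the output side, the density formula
    \<open>lborel\<close>; both have the same measurable sets, and \<open>distr\<close> sees only
    those of its target.\<close>
  have "PN.P.mutual_information b P borel fst (\<lambda>(w, z). f w + z)
      = PN.P.mutual_information b P lborel fst (\<lambda>(w, z). f w + z)"
  proof -
    have "distr ?M borel (\<lambda>(w, z). f w + z) = distr ?M lborel (\<lambda>(w, z). f w + z)"
      "distr ?M (P \<Otimes>\<^sub>M borel) (\<lambda>x. (fst x, case x of (w, z) \<Rightarrow> f w + z))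
        = distr ?M (P \<Otimes>\<^sub>M lborel) (\<lambda>x. (fst x, case x of (w, z) \<Rightarrow> f w + z))"
      by (intro distr_cong sets_pair_measure_cong; simp)+
    then show ?thesis by (simp only: PN.P.mutual_information_def)
  qed
  also have "\<dots> = (\<integral>x. (case x of (w, y) \<Rightarrow> normal_density 0 \<sigma> (y - f w)) *
      log b ((case x of (w, y) \<Rightarrow> normal_density 0 \<sigma> (y - f w)) / (1 * q (snd x))) \<partial>(P \<Otimes>\<^sub>M lborel))"
    by (rule M.mutual_information_distr[OF P.sigma_finite_measure_axioms
          lborel.sigma_finite_measure_axioms X _ Y])
      (use joint in \<open>auto simp: q_def intro!: integral_nonneg_AE\<close>)
  finally show ?thesis
    unfolding gaussian_channel_information_def by (simp add: case_prod_unfold)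
qed

text \<open>Change of variables along \<open>f\<close> on the input side and the identity on the
  output side; both channels have the same output density \<open>q\<close>.\<close>

lemma gaussian_channel_information_distr:
  fixes f :: "'a \<Rightarrow> real"
  assumes "prob_space P" and f[measurable]: "f \<in> borel_measurable P" and "\<sigma> > 0" and "b > 1"
  shows "gaussian_channel_information b \<sigma> (\<lambda>s. s) (distr P borel f)
    = gaussian_channel_information b \<sigma> f P"
proof -
  interpret P: prob_space P by fact
  have D: "prob_space (distr P borel f)" by (rule P.prob_space_distr) simp
  have pair: "distr P borel f \<Otimes>\<^sub>M lborel
      = distr (P \<Otimes>\<^sub>M lborel) (borel \<Otimes>\<^sub>M lborel) (\<lambda>(w, y). (f w, y))"
    using pair_measure_distr[of f P borel "\<lambda>y. y" lborel lborel]
    by (simp add: distr_id2 lborel.sigma_finite_measure_axioms)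
  define q where "q = (\<lambda>y. \<integral>s. normal_density 0 \<sigma> (y - s) \<partial>distr P borel f)"
  have q: "q y = (\<integral>w. normal_density 0 \<sigma> (y - f w) \<partial>P)" for y
    unfolding q_def by (subst integral_distr) auto
  have q_meas[measurable]: "q \<in> borel_measurable borel"
  proof -
    interpret D: prob_space "distr P borel f" by (rule D)
    show ?thesis unfolding q_def by measurable
  qed
  have "gaussian_channel_information b \<sigma> (\<lambda>s. s) (distr P borel f)
    = (\<integral>(s, y). normal_density 0 \<sigma> (y - s) * log b (normal_density 0 \<sigma> (y - s) / q y)
      \<partial>(distr P borel f \<Otimes>\<^sub>M lborel))"
    unfolding q_def using D assms
    by (subst gaussian_channel_information_eq_integral) auto
  also have "\<dots> = (\<integral>(w, y). normal_density 0 \<sigma> (y - f w) * log b (normal_density 0 \<sigma> (y - f w) / q y)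
      \<partial>(P \<Otimes>\<^sub>M lborel))"
    unfolding pair by (subst integral_distr) (auto simp: case_prod_unfold)
  also have "\<dots> = gaussian_channel_information b \<sigma> f P"
    unfolding q by (rule gaussian_channel_information_eq_integral[OF assms, symmetric])
  finally show ?thesis .
qed

section \<open>Topological support and almost sure containment\<close>

text \<open>Forward, each point outside \<open>C\<close> has a null open neighbourhood, and Lindelof
  reduces the union of all null open sets to a countable one, which is null. Backward, the
  complement of \<open>C\<close> is itself open and null.\<close>

lemma measure_support_subset_iff_AE:
  fixes C :: "'a::second_countable_topology set"
  assumes "closed C" and sets: "sets P = sets borel"
  shows "measure_support P \<subseteq> C \<longleftrightarrow> (AE x in P. x \<in> C)"
proof
  assume supp: "measure_support P \<subseteq> C"
  define \<F> where "\<F> = {U. open U \<and> emeasure P U = 0}"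
  obtain \<F>' where \<F>': "\<F>' \<subseteq> \<F>" "countable \<F>'" "\<Union>\<F>' = \<Union>\<F>"
    using Lindelof[of \<F>] by (auto simp: \<F>_def)
  have "(\<Union>U\<in>\<F>'. U) \<in> null_sets P"
    using \<F>' by (intro null_sets_UN') (auto simp: \<F>_def null_sets_def sets)
  moreover have "- C \<subseteq> \<Union>\<F>"
  proof
    fix x assume "x \<in> - C"
    then have "x \<notin> measure_support P" using supp by blast
    then show "x \<in> \<Union>\<F>" by (auto simp: measure_support_def \<F>_def)
  qed
  ultimately show "AE x in P. x \<in> C"
    using \<F>'(3) by (intro AE_I'[of "\<Union>\<F>'"]) auto
next
  assume AE: "AE x in P. x \<in> C"
  have "- C \<in> sets P" using \<open>closed C\<close> sets by auto
  with AE have "emeasure P (- C) = 0"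
    using AE_iff_measurable[of "- C" P "\<lambda>x. x \<in> C"] sets_eq_imp_space_eq[OF sets] by auto
  moreover have "open (- C)" using \<open>closed C\<close> by (rule open_Compl)
  ultimately show "measure_support P \<subseteq> C"
    unfolding measure_support_def using less_irrefl[of "0::ennreal"] by force
qed

section \<open>Weighted majorization by pairwise averaging\<close>

text \<open>Weighted Hardy--Littlewood--Polya: each step moves weight from an index above its target to
  a later one below its target until one of the two meets it, so the number of mismatches
  with \<open>\<alpha>\<close> drops. The vector \<open>\<beta>\<close> need not be sorted.\<close>

lemma weighted_majorization_induct:
  fixes h \<alpha> \<beta> :: "nat \<Rightarrow> real" and Q :: "(nat \<Rightarrow> real) \<Rightarrow> bool"
  assumes h: "\<And>k. k \<in> {1..n} \<Longrightarrow> h k > 0"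
    and \<alpha>: "\<And>i j. 1 \<le> i \<Longrightarrow> i < j \<Longrightarrow> j \<le> n \<Longrightarrow> \<alpha> j \<le> \<alpha> i"
    and le: "\<And>k. k \<le> n \<Longrightarrow> (\<Sum>i=1..k. h i * \<alpha> i) \<le> (\<Sum>i=1..k. h i * \<beta> i)"
    and eq: "(\<Sum>i=1..n. h i * \<beta> i) = (\<Sum>i=1..n. h i * \<alpha> i)"
    and "Q \<beta>"
    and transfer: "\<And>\<gamma> i j u v. Q \<gamma> \<Longrightarrow> i \<in> {1..n} \<Longrightarrow> j \<in> {1..n} \<Longrightarrow> i < j \<Longrightarrow>
      u \<in> {0..1} \<Longrightarrow> v \<in> {0..1} \<Longrightarrow> h i * u = h j * v \<Longrightarrow>
      Q (\<gamma>(i := \<gamma> i + u * (\<gamma> j - \<gamma> i), j := \<gamma> j + v * (\<gamma> i - \<gamma> j)))"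
  shows "\<exists>\<gamma>. Q \<gamma> \<and> (\<forall>k\<in>{1..n}. \<gamma> k = \<alpha> k)"
  using le eq \<open>Q \<beta>\<close>
proof (induction "card {k\<in>{1..n}. \<beta> k \<noteq> \<alpha> k}" arbitrary: \<beta> rule: less_induct)
  case less
  show ?case
  proof (cases "\<exists>j\<in>{1..n}. \<beta> j < \<alpha> j")
    \<comment> \<open>Without a deficit, equal totals and positive weights force equality in every
      coordinate.\<close>
    case False
    then have nn: "\<forall>k\<in>{1..n}. 0 \<le> h k * (\<beta> k - \<alpha> k)"
      using h by (simp add: less_imp_le linorder_not_less)
    have "(\<Sum>k=1..n. h k * (\<beta> k - \<alpha> k)) = 0"
      using less.prems(2) by (simp add: right_diff_distrib sum_subtractf)
    then have "\<forall>k\<in>{1..n}. h k * (\<beta> k - \<alpha> k) = 0"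
      using nn by (subst (asm) sum_nonneg_eq_0_iff) auto
    then have "\<forall>k\<in>{1..n}. \<beta> k = \<alpha> k" using h by fastforce
    then show ?thesis using less.prems(3) by blast
  next
    case True
    define j where "j = (LEAST j. j \<in> {1..n} \<and> \<beta> j < \<alpha> j)"
    have j: "j \<in> {1..n}" "\<beta> j < \<alpha> j"
      unfolding j_def using LeastI_ex[of "\<lambda>j. j \<in> {1..n} \<and> \<beta> j < \<alpha> j"] True by blast+
    have below_j: "\<alpha> l \<le> \<beta> l" if "l \<in> {1..<j}" for l
      using that not_less_Least[of l "\<lambda>j. j \<in> {1..n} \<and> \<beta> j < \<alpha> j", folded j_def] j(1)
      by auto
    \<comment> \<open>If no earlier index had a surplus, the deficit at \<open>j\<close> would break
      the prefix inequality at \<open>j\<close>.\<close>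
    have "\<exists>i\<in>{1..<j}. \<alpha> i < \<beta> i"
    proof (rule ccontr)
      assume "\<not> ?thesis"
      then have "(\<Sum>i=1..<j. h i * \<beta> i) \<le> (\<Sum>i=1..<j. h i * \<alpha> i)"
        using h j(1) by (intro sum_mono mult_left_mono) (auto simp: not_less less_imp_le)
      moreover have "h j * \<beta> j < h j * \<alpha> j" using h j by simp
      ultimately have "(\<Sum>i=1..j. h i * \<beta> i) < (\<Sum>i=1..j. h i * \<alpha> i)"
        using j(1) by (simp add: flip: atLeastLessThanSuc_atLeastAtMost)
      then show False using less.prems(1)[of j] j(1) by simp
    qed
    then obtain i where i: "1 \<le> i" "i < j" "\<alpha> i < \<beta> i" by auto
    have hi: "h i > 0" and hj: "h j > 0" and in_n: "i \<in> {1..n}" using h i j by auto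
    have \<alpha>ij: "\<alpha> j \<le> \<alpha> i" using \<alpha> i j by simp
    define D where "D = \<beta> i - \<beta> j"
    have D: "D > 0" using i j \<alpha>ij by (simp add: D_def)
    \<comment> \<open>the largest weighted amount that can move from \<open>i\<close> to \<open>j\<close> without overshooting \<open>\<alpha>\<close>\<close>
    define \<delta> where "\<delta> = min (h i * (\<beta> i - \<alpha> i)) (h j * (\<alpha> j - \<beta> j))"
    have \<delta>: "\<delta> > 0" "\<delta> \<le> h i * (\<beta> i - \<alpha> i)" "\<delta> \<le> h j * (\<alpha> j - \<beta> j)"
      using hi hj i j by (auto simp: \<delta>_def)
    \<comment> \<open>Fractions of the gap \<open>D\<close> that lower entry \<open>i\<close> by
      \<open>\<delta> / h i\<close> and raise entry \<open>j\<close> by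
      \<open>\<delta> / h j\<close>: either change carries the weight
      \<open>\<delta>\<close>.\<close>
    define u where "u = \<delta> / (h i * D)"
    define v where "v = \<delta> / (h j * D)"
    \<comment> \<open>The chain \<open>\<beta> j < \<alpha> j \<le> \<alpha> i < \<beta> i\<close>
      makes \<open>D\<close> at least the surplus at \<open>i\<close> and the deficit at
      \<open>j\<close>, so \<open>u\<close> and \<open>v\<close> are at most 1.\<close>
    have "\<delta> \<le> h i * D" "\<delta> \<le> h j * D"
      using \<delta> hi hj i j \<alpha>ij
      by (auto simp: D_def intro: order.trans[OF _ mult_left_mono])
    then have uv: "u \<in> {0..1}" "v \<in> {0..1}" "h i * u = h j * v"
      using hi hj D \<delta> by (auto simp: u_def v_def)
    define \<gamma> where "\<gamma> = \<beta>(i := \<beta> i + u * (\<beta> j - \<beta> i), j := \<beta> j + v * (\<beta> i - \<beta> j))"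
    have Q: "Q \<gamma>"
      unfolding \<gamma>_def by (rule transfer) (use less.prems(3) in_n j i uv in auto)
    have \<gamma>i: "\<gamma> i = \<beta> i - \<delta> / h i" and \<gamma>j: "\<gamma> j = \<beta> j + \<delta> / h j"
      using hi hj D i by (auto simp: \<gamma>_def u_def v_def D_def field_simps)
    have \<gamma>_other: "\<gamma> k = \<beta> k" if "k \<noteq> i" "k \<noteq> j" for k using that by (simp add: \<gamma>_def)
    have wt: "h k * \<gamma> k = h k * \<beta> k + ((if k = j then \<delta> else 0) - (if k = i then \<delta> else 0))" for k
      using i(2) hi hj \<gamma>_other[of k] \<gamma>i \<gamma>j by (auto simp: field_simps)
    have sum_\<gamma>: "(\<Sum>k=1..m. h k * \<gamma> k) = (\<Sum>k=1..m. h k * \<beta> k)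
        + ((if j \<le> m then \<delta> else 0) - (if i \<le> m then \<delta> else 0))" for m
      using i j by (simp add: wt sum.distrib sum_subtractf sum.delta)
    \<comment> \<open>Before \<open>j\<close> every entry of \<open>\<gamma>\<close> still lies at
      or above its target; from \<open>j\<close> on the transfer cancels in the prefix sum.\<close>
    have le': "(\<Sum>i=1..k. h i * \<alpha> i) \<le> (\<Sum>i=1..k. h i * \<gamma> i)" if "k \<le> n" for k
    proof (cases "k < j")
      case True
      have "\<alpha> l \<le> \<gamma> l" if "l \<in> {1..k}" for l
      proof (cases "l = i")
        case l: True
        have "\<delta> / h i \<le> \<beta> i - \<alpha> i" using \<delta> hi by (simp add: field_simps)
        then show ?thesis using l \<gamma>i by simp
      next
        case False
        then show ?thesis using that True below_j[of l] \<gamma>_other[of l] by simp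
      qed
      then show ?thesis
        using h \<open>k \<le> n\<close> by (intro sum_mono mult_left_mono) (auto simp: less_imp_le)
    next
      case False
      then show ?thesis unfolding sum_\<gamma> using i less.prems(1)[OF \<open>k \<le> n\<close>] by simp
    qed
    have eq': "(\<Sum>i=1..n. h i * \<gamma> i) = (\<Sum>i=1..n. h i * \<alpha> i)"
      unfolding sum_\<gamma> using less.prems(2) i j by simp
    \<comment> \<open>Since \<open>\<delta>\<close> is a minimum, one of the two entries reaches its
      target. Both were mismatched before, so the mismatch set shrinks strictly.\<close>
    have "\<gamma> i = \<alpha> i \<or> \<gamma> j = \<alpha> j"
      using hi hj by (auto simp: \<gamma>i \<gamma>j \<delta>_def min_def field_simps)
    then have "{k\<in>{1..n}. \<gamma> k \<noteq> \<alpha> k} \<subset> {k\<in>{1..n}. \<beta> k \<noteq> \<alpha> k}"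
      using i j in_n \<gamma>_other by (auto simp: psubset_eq set_eq_iff) (metis less_irrefl)+
    then have "card {k\<in>{1..n}. \<gamma> k \<noteq> \<alpha> k} < card {k\<in>{1..n}. \<beta> k \<noteq> \<alpha> k}"
      by (intro psubset_card_mono) auto
    then show ?thesis using le' eq' Q by (rule less.hyps)
  qed
qed

section \<open>Water-filling profiles and the excess bound\<close>

text \<open>For \<open>k \<ge> 1\<close> and \<open>h k > 0\<close> this is
  \<open>(s - gain_sum h (k - 1)) / h k\<close> clipped to the unit interval: coordinate
  \<open>k\<close> starts to fill once the earlier ones are full. Differences of positive parts make
  weighted sums telescope.\<close>

definition water_filling :: "(nat \<Rightarrow> real) \<Rightarrow> nat \<Rightarrow> real \<Rightarrow> real" where
  "water_filling h k s = (max (s - gain_sum h (k - 1)) 0 - max (s - gain_sum h k) 0) / h k"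

lemma gain_sum_pred: "1 \<le> k \<Longrightarrow> gain_sum h k = gain_sum h (k - 1) + h k"
  by (cases k) (auto simp: gain_sum_def)

lemma gain_sum_add_tail: "k \<le> n \<Longrightarrow> gain_sum h k + (\<Sum>i=k+1..n. h i) = (\<Sum>i=1..n. h i)"
  unfolding gain_sum_def using sum.ub_add_nat[of 1 k h "n - k"] by simp

lemma water_filling_measurable [measurable]: "water_filling h k \<in> borel_measurable borel"
  unfolding water_filling_def by measurable

lemma water_filling_bounds:
  assumes "1 \<le> k" "h k > 0"
  shows "water_filling h k s \<in> {0..1}"
  using assms by (auto simp: water_filling_def gain_sum_pred[OF assms(1)] field_simps)

lemma sum_water_filling:
  assumes "\<And>k. k \<in> {1..n} \<Longrightarrow> h k > 0" and "m \<le> n"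
  shows "(\<Sum>k=1..m. h k * water_filling h k s) = max s 0 - max (s - gain_sum h m) 0"
  using \<open>m \<le> n\<close>
proof (induction m)
  case 0
  then show ?case by (simp add: gain_sum_def)
next
  case (Suc m)
  then have "h (Suc m) * water_filling h (Suc m) s = max (s - gain_sum h m) 0 - max (s - gain_sum h (Suc m)) 0"
    using assms(1)[of "Suc m"] by (simp add: water_filling_def)
  then show ?case using Suc by simp
qed

text \<open>The first \<open>m\<close> coordinates, each at most 1, contribute at most
  \<open>gain_sum h m\<close>; any excess over that level must come from the tail.\<close>

lemma positive_part_excess_le:
  fixes h x :: "nat \<Rightarrow> real"
  assumes h: "\<And>k. k \<in> {1..n} \<Longrightarrow> h k \<ge> 0" and x: "\<And>k. k \<in> {1..n} \<Longrightarrow> x k \<in> {0..1}" and "m \<le> n"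
  shows "max ((\<Sum>k=1..n. h k * x k) - gain_sum h m) 0 \<le> (\<Sum>k=m+1..n. h k * x k)"
proof -
  \<comment> \<open>Here \<open>gain_sum\<close> is applied to the products
    \<open>h k * x k\<close>, so the splitting of the weights becomes a splitting of the
    signal.\<close>
  have "(\<Sum>k=1..n. h k * x k) = (\<Sum>k=1..m. h k * x k) + (\<Sum>k=m+1..n. h k * x k)"
    using gain_sum_add_tail[OF \<open>m \<le> n\<close>, of "\<lambda>k. h k * x k"] by (simp add: gain_sum_def)
  moreover have "(\<Sum>k=1..m. h k * x k) \<le> gain_sum h m"
    unfolding gain_sum_def using h x \<open>m \<le> n\<close> by (intro sum_mono mult_left_le) auto
  moreover have "0 \<le> (\<Sum>k=m+1..n. h k * x k)"
    using h x by (intro sum_nonneg mult_nonneg_nonneg) auto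
  ultimately show ?thesis by simp
qed

section \<open>Coordinate profiles with prescribed means\<close>

text \<open>Makes the constraints sufficient: the input can be chosen as a deterministic function
  \<open>\<phi>\<close> of the signal. Water-filling loads the early coordinates as much as
  possible, so its means majorize \<open>\<alpha>\<close>, and averaging corrects them.\<close>

lemma ex_coordinate_profiles:
  fixes h \<alpha> :: "nat \<Rightarrow> real"
  assumes h: "\<And>k. k \<in> {1..n} \<Longrightarrow> h k > 0" and "(\<Sum>k=1..n. h k) = 1"
    and \<alpha>: "\<And>i j. 1 \<le> i \<Longrightarrow> i < j \<Longrightarrow> j \<le> n \<Longrightarrow> \<alpha> j \<le> \<alpha> i"
    and "prob_space P" and sets[measurable_cong]: "sets P = sets borel"
    and supp: "AE s in P. s \<in> {0..1}"
    and mean: "(\<integral>s. s \<partial>P) = (\<Sum>k=1..n. h k * \<alpha> k)"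
    and excess: "\<And>m. 1 \<le> m \<Longrightarrow> m < n \<Longrightarrow> (\<integral>s. max (s - gain_sum h m) 0 \<partial>P) \<le> (\<Sum>k=m+1..n. h k * \<alpha> k)"
  shows "\<exists>\<phi>. (\<forall>k\<in>{1..n}. \<phi> k \<in> borel_measurable borel \<and> (\<forall>s. \<phi> k s \<in> {0..1}) \<and> (\<integral>s. \<phi> k s \<partial>P) = \<alpha> k) \<and>
    (\<forall>s\<in>{0..1}. (\<Sum>k=1..n. h k * \<phi> k s) = s)"
proof -
  interpret P: prob_space P by fact
  \<comment> \<open>The properties that averaging preserves; the means change and are tracked
    separately.\<close>
  define profile :: "(nat \<Rightarrow> real \<Rightarrow> real) \<Rightarrow> bool" where
    "profile \<phi> \<longleftrightarrow> (\<forall>k\<in>{1..n}. \<phi> k \<in> borel_measurable borel \<and> (\<forall>s. \<phi> k s \<in> {0..1})) \<and>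
      (\<forall>s\<in>{0..1}. (\<Sum>k=1..n. h k * \<phi> k s) = s)" for \<phi>
  have borel_P: "measurable P borel = (borel_measurable borel :: (real \<Rightarrow> real) set)"
    by (rule measurable_cong_sets) (simp_all add: sets)
  have integrable: "integrable P (\<phi> k)" if "profile \<phi>" "k \<in> {1..n}" for \<phi> k
    using that by (intro P.integrable_const_bound[where B=1]) (auto simp: profile_def borel_P)
  have int_sub: "integrable P (\<lambda>s. max (s - c) 0)" for c
  proof (rule P.integrable_const_bound)
    show "AE s in P. norm (max (s - c) 0) \<le> 1 + \<bar>c\<bar>" using supp by eventually_elim auto
  qed measurable
  define \<beta> where "\<beta> k = (\<integral>s. water_filling h k s \<partial>P)" for k
  have gain_n: "gain_sum h n = 1" using assms(2) by (simp add: gain_sum_def)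
  have sum_wf: "(\<Sum>k=1..m. h k * water_filling h k s) = max s 0 - max (s - gain_sum h m) 0"
    if "m \<le> n" for m s
    using h that by (rule sum_water_filling)
  have wf: "profile (water_filling h)"
    unfolding profile_def
  proof (intro conjI ballI allI)
    show "water_filling h k s \<in> {0..1}" if "k \<in> {1..n}" for k s
      using that h by (intro water_filling_bounds) auto
    show "(\<Sum>k=1..n. h k * water_filling h k s) = s" if "s \<in> {0..1}" for s
      unfolding sum_wf[OF order.refl] gain_n using that by simp
  qed measurable
  \<comment> \<open>Telescoping in expectation: a prefix sum of the means is the mean signal minus
    the expected excess, so upper bounds on the excess become lower bounds on prefix sums.\<close>
  have sum_\<beta>: "(\<Sum>k=1..m. h k * \<beta> k) = (\<Sum>k=1..n. h k * \<alpha> k) - (\<integral>s. max (s - gain_sum h m) 0 \<partial>P)"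
    if "m \<le> n" for m
  proof -
    have "(\<Sum>k=1..m. h k * \<beta> k) = (\<integral>s. (\<Sum>k=1..m. h k * water_filling h k s) \<partial>P)"
      unfolding \<beta>_def using that integrable[OF wf]
      by (subst Bochner_Integration.integral_sum) auto
    also have "\<dots> = (\<integral>s. max s 0 - max (s - gain_sum h m) 0 \<partial>P)"
      unfolding sum_wf[OF that] ..
    also have "\<dots> = (\<integral>s. max s 0 \<partial>P) - (\<integral>s. max (s - gain_sum h m) 0 \<partial>P)"
      using int_sub[of 0] int_sub by (subst Bochner_Integration.integral_diff) auto
    also have "(\<integral>s. max s 0 \<partial>P) = (\<integral>s. s \<partial>P)"
    proof (rule integral_cong_AE)
      show "AE s in P. max s 0 = s" using supp by eventually_elim auto
    qed auto
    finally show ?thesis using mean by simp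
  qed
  have excess_n: "(\<integral>s. max (s - gain_sum h n) 0 \<partial>P) = 0"
  proof (rule integral_eq_zero_AE)
    show "AE s in P. max (s - gain_sum h n) 0 = 0" using supp by eventually_elim (auto simp: gain_n)
  qed
  have eq: "(\<Sum>k=1..n. h k * \<beta> k) = (\<Sum>k=1..n. h k * \<alpha> k)"
    using sum_\<beta>[of n] excess_n by simp
  \<comment> \<open>The excess constraints cover only \<open>0 < m < n\<close>; at
    \<open>m = 0\<close> both sums are empty and at \<open>m = n\<close> the totals agree.\<close>
  have le: "(\<Sum>k=1..m. h k * \<alpha> k) \<le> (\<Sum>k=1..m. h k * \<beta> k)" if "m \<le> n" for m
  proof (cases "m = 0 \<or> m = n")
    case True
    then show ?thesis using eq by auto
  next
    case False
    then show ?thesis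
      using that excess[of m] sum_\<beta>[of m] gain_sum_add_tail[OF that, of "\<lambda>k. h k * \<alpha> k"]
      by (simp add: gain_sum_def)
  qed
  \<comment> \<open>The induction runs on mean vectors, with the predicate that some profile family
    realizes the vector.\<close>
  have "\<exists>\<gamma>. (\<exists>\<phi>. profile \<phi> \<and> (\<forall>k\<in>{1..n}. (\<integral>s. \<phi> k s \<partial>P) = \<gamma> k)) \<and> (\<forall>k\<in>{1..n}. \<gamma> k = \<alpha> k)"
    using h \<alpha> le eq
  proof (rule weighted_majorization_induct)
    show "\<exists>\<phi>. profile \<phi> \<and> (\<forall>k\<in>{1..n}. (\<integral>s. \<phi> k s \<partial>P) = \<beta> k)"
      using wf by (auto simp: \<beta>_def)
  next
    fix \<gamma> i j u v
    assume "\<exists>\<phi>. profile \<phi> \<and> (\<forall>k\<in>{1..n}. (\<integral>s. \<phi> k s \<partial>P) = \<gamma> k)"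
    then obtain \<phi> where \<phi>: "profile \<phi>" and int: "\<And>k. k \<in> {1..n} \<Longrightarrow> (\<integral>s. \<phi> k s \<partial>P) = \<gamma> k"
      by blast
    assume ij: "i \<in> {1..n}" "j \<in> {1..n}" "i < j"
      and uv: "u \<in> {0..1}" "v \<in> {0..1}" "h i * u = h j * v"
    define \<psi> where "\<psi> = \<phi>(i := \<lambda>s. \<phi> i s + u * (\<phi> j s - \<phi> i s), j := \<lambda>s. \<phi> j s + v * (\<phi> i s - \<phi> j s))"
    have mix: "a + t * (c - a) \<in> {0..1}" if "a \<in> {0..1}" "c \<in> {0..1}" "t \<in> {0..1}" for a c t :: real
      using that convexD_alt[OF convex_real_interval(5), of a 0 1 c t] by (simp add: algebra_simps)
    have "profile \<psi>"
      unfolding profile_def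
    proof (intro conjI ballI allI)
      have meas: "\<phi> k \<in> borel_measurable borel" if "k \<in> {1..n}" for k
        using that \<phi> by (simp add: profile_def)
      note [measurable] = meas[OF ij(1)] meas[OF ij(2)]
      show "\<psi> k \<in> borel_measurable borel" if "k \<in> {1..n}" for k
        using meas[OF that] by (auto simp: \<psi>_def)
      show "\<psi> k s \<in> {0..1}" if "k \<in> {1..n}" for k s
        using that \<phi> ij uv(1,2) mix by (auto simp: \<psi>_def profile_def simp del: atLeastAtMost_iff)
      fix s :: real assume s: "s \<in> {0..1}"
      \<comment> \<open>The weighted changes at \<open>i\<close> and \<open>j\<close> are opposite
        because \<open>h i * u = h j * v\<close>, so the signal is unchanged.\<close>
      have "h k * \<psi> k s = h k * \<phi> k s + ((if k = i then h i * u * (\<phi> j s - \<phi> i s) else 0)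
          - (if k = j then h j * v * (\<phi> j s - \<phi> i s) else 0))" for k
        using ij by (auto simp: \<psi>_def algebra_simps)
      then have "(\<Sum>k=1..n. h k * \<psi> k s) = (\<Sum>k=1..n. h k * \<phi> k s)"
        using ij uv(3) by (simp add: sum.distrib sum_subtractf sum.delta)
      then show "(\<Sum>k=1..n. h k * \<psi> k s) = s" using \<phi> s by (simp add: profile_def)
    qed
    moreover have "(\<integral>s. \<psi> k s \<partial>P) = (\<gamma>(i := \<gamma> i + u * (\<gamma> j - \<gamma> i), j := \<gamma> j + v * (\<gamma> i - \<gamma> j))) k"
      if "k \<in> {1..n}" for k
      using that ij integrable[OF \<phi>] int by (auto simp: \<psi>_def)
    ultimately show "\<exists>\<phi>. profile \<phi> \<and> (\<forall>k\<in>{1..n}. (\<integral>s. \<phi> k s \<partial>P)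
        = (\<gamma>(i := \<gamma> i + u * (\<gamma> j - \<gamma> i), j := \<gamma> j + v * (\<gamma> i - \<gamma> j))) k)"
      by blast
  qed
  then obtain \<gamma> \<phi> where "profile \<phi>" "\<forall>k\<in>{1..n}. (\<integral>s. \<phi> k s \<partial>P) = \<gamma> k" "\<forall>k\<in>{1..n}. \<gamma> k = \<alpha> k"
    by blast
  then have "(\<forall>k\<in>{1..n}. \<phi> k \<in> borel_measurable borel \<and> (\<forall>s. \<phi> k s \<in> {0..1}) \<and>
      (\<integral>s. \<phi> k s \<partial>P) = \<alpha> k) \<and> (\<forall>s\<in>{0..1}. (\<Sum>k=1..n. h k * \<phi> k s) = s)"
    unfolding profile_def by simp
  then show ?thesis by blast
qed

section \<open>Laws of the signal arising from admissible inputs\<close>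

definition sum_signal_laws :: "nat \<Rightarrow> (nat \<Rightarrow> real) \<Rightarrow> (nat \<Rightarrow> real) \<Rightarrow> real measure set" where
  "sum_signal_laws n h \<alpha> = {P. prob_space P \<and> sets P = sets borel \<and>
     measure_support P \<subseteq> {0..1} \<and>
     (\<integral>s. s \<partial>P) = (\<Sum>k=1..n. h k * \<alpha> k) \<and>
     (\<forall>k\<in>{1..n-1}. (\<integral>s. max (s - gain_sum h k) 0 \<partial>P)
                      \<le> (1 - gain_sum h k) * tail_mean n h \<alpha> k)}"

text \<open>For \<open>m < n\<close> the denominator \<open>1 - gain_sum h m\<close> is a nonempty
  sum of positive weights, so the division in \<open>tail_mean\<close> is genuine and
  cancels.\<close>

lemma tail_mean_numerator:
  assumes "\<And>k. k \<in> {1..n} \<Longrightarrow> h k > 0" "(\<Sum>k=1..n. h k) = 1" "m < n"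
  shows "(1 - gain_sum h m) * tail_mean n h \<alpha> m = (\<Sum>k=m+1..n. h k * \<alpha> k)"
proof -
  have "(\<Sum>k=m+1..n. h k) > 0" using assms by (intro sum_pos) auto
  then show ?thesis using gain_sum_add_tail[of m n h] assms by (simp add: tail_mean_def)
qed

text \<open>One inclusion integrates the pointwise excess bound; the other feeds the signal through
  coordinate profiles, which return it as their weighted sum.\<close>

lemma distr_EC_input_laws:
  assumes h: "\<And>k. k \<in> {1..n} \<Longrightarrow> h k > 0" and sum_h: "(\<Sum>k=1..n. h k) = 1"
    and \<alpha>: "\<And>i j. 1 \<le> i \<Longrightarrow> i < j \<Longrightarrow> j \<le> n \<Longrightarrow> \<alpha> j \<le> \<alpha> i"
  shows "(\<lambda>P. distr P borel (\<lambda>x. \<Sum>k=1..n. h k * x k)) ` EC_input_laws n \<alpha> = sum_signal_laws n h \<alpha>"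
proof (intro equalityI subsetI)
  fix Q assume "Q \<in> (\<lambda>P. distr P borel (\<lambda>x. \<Sum>k=1..n. h k * x k)) ` EC_input_laws n \<alpha>"
  then obtain P where Q: "Q = distr P borel (\<lambda>x. \<Sum>k=1..n. h k * x k)" and "prob_space P"
    and sets[measurable_cong]: "sets P = sets (PiM {1..n} (\<lambda>_. borel))"
    and bounds: "AE x in P. \<forall>k\<in>{1..n}. 0 \<le> x k \<and> x k \<le> 1"
    and mean: "\<And>k. k \<in> {1..n} \<Longrightarrow> (\<integral>x. x k \<partial>P) = \<alpha> k"
    by (auto simp: EC_input_laws_def)
  interpret P: prob_space P by fact
  have f[measurable]: "(\<lambda>x. \<Sum>k=1..n. h k * x k) \<in> borel_measurable P" by measurable
  have int: "integrable P (\<lambda>x. x k)" if "k \<in> {1..n}" for k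
    using that bounds by (intro P.integrable_const_bound[where B=1]) (auto elim!: eventually_mono)
  have sum_mean: "(\<integral>x. (\<Sum>k\<in>A. h k * x k) \<partial>P) = (\<Sum>k\<in>A. h k * \<alpha> k)" if "A \<subseteq> {1..n}" for A
    using that int mean by (subst Bochner_Integration.integral_sum) (auto simp: subset_eq intro!: sum.cong)
  have int_sum: "integrable P (\<lambda>x. \<Sum>k\<in>A. h k * x k)" if "A \<subseteq> {1..n}" for A
    using that int by (auto simp: subset_eq)
  have "measure_support Q \<subseteq> {0..1}"
  proof -
    have "(\<Sum>k=1..n. h k * x k) \<in> {0..1}" if "\<forall>k\<in>{1..n}. 0 \<le> x k \<and> x k \<le> 1" for x :: "nat \<Rightarrow> real"
    proof -
      have "(\<Sum>k=1..n. h k * x k) \<le> (\<Sum>k=1..n. h k)"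
        using that h by (intro sum_mono mult_left_le) (auto simp: less_imp_le)
      moreover have "0 \<le> (\<Sum>k=1..n. h k * x k)"
        using that h by (intro sum_nonneg mult_nonneg_nonneg) (auto simp: less_imp_le)
      ultimately show ?thesis using sum_h by simp
    qed
    then have "AE x in P. (\<Sum>k=1..n. h k * x k) \<in> {0..1}"
      using bounds by (auto elim!: eventually_mono simp del: atLeastAtMost_iff)
    then show ?thesis
      unfolding Q by (subst measure_support_subset_iff_AE) (auto simp: AE_distr_iff simp del: atLeastAtMost_iff)
  qed
  moreover have "(\<integral>s. s \<partial>Q) = (\<Sum>k=1..n. h k * \<alpha> k)"
    unfolding Q by (subst integral_distr) (auto simp: sum_mean)
  moreover have "(\<integral>s. max (s - gain_sum h m) 0 \<partial>Q) \<le> (1 - gain_sum h m) * tail_mean n h \<alpha> m"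
    if "m \<in> {1..n-1}" for m
  proof -
    have m: "m < n" using that by auto
    have "(\<integral>s. max (s - gain_sum h m) 0 \<partial>Q) = (\<integral>x. max ((\<Sum>k=1..n. h k * x k) - gain_sum h m) 0 \<partial>P)"
      unfolding Q by (subst integral_distr) auto
    also have "\<dots> \<le> (\<integral>x. (\<Sum>k=m+1..n. h k * x k) \<partial>P)"
    proof (rule integral_mono_AE)
      show "AE x in P. max ((\<Sum>k=1..n. h k * x k) - gain_sum h m) 0 \<le> (\<Sum>k=m+1..n. h k * x k)"
        using bounds by eventually_elim (use h m in \<open>intro positive_part_excess_le; auto simp: less_imp_le\<close>)
    qed (use int_sum[of "{1..n}"] int_sum[of "{m+1..n}"] in auto)
    also have "\<dots> = (1 - gain_sum h m) * tail_mean n h \<alpha> m"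
      using tail_mean_numerator[OF h sum_h m] by (subst sum_mean) auto
    finally show ?thesis .
  qed
  moreover have "prob_space Q" unfolding Q by (rule P.prob_space_distr) simp
  ultimately show "Q \<in> sum_signal_laws n h \<alpha>"
    by (auto simp: sum_signal_laws_def Q)
next
  fix P assume "P \<in> sum_signal_laws n h \<alpha>"
  then have "prob_space P" and sets[measurable_cong]: "sets P = sets borel"
    and constr: "\<forall>m\<in>{1..n-1}. (\<integral>s. max (s - gain_sum h m) 0 \<partial>P) \<le> (1 - gain_sum h m) * tail_mean n h \<alpha> m"
    and supp: "measure_support P \<subseteq> {0..1}"
    and mean: "(\<integral>s. s \<partial>P) = (\<Sum>k=1..n. h k * \<alpha> k)"
    by (auto simp: sum_signal_laws_def)
  have excess: "(\<integral>s. max (s - gain_sum h m) 0 \<partial>P) \<le> (\<Sum>k=m+1..n. h k * \<alpha> k)"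
    if "1 \<le> m" "m < n" for m
    using constr[rule_format, of m] that tail_mean_numerator[OF h sum_h that(2), of \<alpha>] by simp
  interpret P: prob_space P by fact
  have AE: "AE s in P. s \<in> {0..1}"
    using measure_support_subset_iff_AE[OF _ sets, of "{0..1}"] supp by simp
  obtain \<phi> where \<phi>: "\<And>k. k \<in> {1..n} \<Longrightarrow> \<phi> k \<in> borel_measurable borel"
    "\<And>k s. k \<in> {1..n} \<Longrightarrow> \<phi> k s \<in> {0..1}"
    "\<And>k. k \<in> {1..n} \<Longrightarrow> (\<integral>s. \<phi> k s \<partial>P) = \<alpha> k"
    "\<And>s. s \<in> {0..1} \<Longrightarrow> (\<Sum>k=1..n. h k * \<phi> k s) = s"
    using ex_coordinate_profiles[OF h sum_h \<alpha> \<open>prob_space P\<close> sets AE mean excess] by blast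
  \<comment> \<open>Restriction to \<open>{1..n}\<close> puts the values of \<open>X\<close> into
    the space of the product measure.\<close>
  define X where "X s = (\<lambda>k\<in>{1..n}. \<phi> k s)" for s
  have X[measurable]: "X \<in> measurable P (PiM {1..n} (\<lambda>_. borel))"
    unfolding X_def measurable_cong_sets[OF sets refl] using \<phi>(1) by (intro measurable_restrict)
  let ?D = "distr P (PiM {1..n} (\<lambda>_. borel)) X"
  have "?D \<in> EC_input_laws n \<alpha>"
    unfolding EC_input_laws_def
  proof (intro CollectI conjI ballI)
    show "prob_space ?D" using X by (rule P.prob_space_distr)
    show "AE x in ?D. \<forall>k\<in>{1..n}. 0 \<le> x k \<and> x k \<le> 1"
      using \<phi>(2) by (subst AE_distr_iff[OF X]) (auto simp: X_def)
    show "(\<integral>x. x k \<partial>?D) = \<alpha> k" if "k \<in> {1..n}" for k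
      using that \<phi>(3) by (subst integral_distr[OF X]) (auto simp: X_def)
  qed simp
  moreover have "P = distr ?D borel (\<lambda>x. \<Sum>k=1..n. h k * x k)"
  proof -
    have "distr ?D borel (\<lambda>x. \<Sum>k=1..n. h k * x k) = distr P borel (\<lambda>s. \<Sum>k=1..n. h k * X s k)"
      by (subst distr_distr[OF _ X]) (auto simp: comp_def)
    \<comment> \<open>The profiles reproduce \<open>s\<close> only on the unit interval, but
      \<open>P\<close> is concentrated there.\<close>
    also have "\<dots> = distr P borel (\<lambda>s. s)"
    proof (rule distr_cong_AE)
      show "AE s in P. (\<Sum>k=1..n. h k * X s k) = s"
        using AE by eventually_elim (use \<phi>(4) in \<open>simp add: X_def\<close>)
      have "(\<lambda>s. X s k) \<in> borel_measurable P" if "k \<in> {1..n}" for k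
        using measurable_compose[OF X measurable_component_singleton[OF that]] .
      then show "(\<lambda>s. \<Sum>k=1..n. h k * X s k) \<in> borel_measurable P" by auto
    qed (auto simp: measurable_cong_sets[OF sets])
    also have "\<dots> = P" by (rule distr_id2) (simp add: sets)
    finally show ?thesis by simp
  qed
  ultimately show "P \<in> (\<lambda>P. distr P borel (\<lambda>x. \<Sum>k=1..n. h k * x k)) ` EC_input_laws n \<alpha>"
    by blast
qed

section \<open>The scalar form of the capacity\<close>

theorem corollary2:
  fixes n :: nat and h \<alpha> :: "nat \<Rightarrow> real" and \<sigma> b :: real
  assumes "n \<ge> 2"
    and "\<And>k. k \<in> {1..n} \<Longrightarrow> h k > 0"
    and "(\<Sum>k=1..n. h k) = 1"
    and "\<alpha> 1 \<le> 1"
    and "\<And>i j. 1 \<le> i \<Longrightarrow> i < j \<Longrightarrow> j \<le> n \<Longrightarrow> \<alpha> i > \<alpha> j"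
    and "\<alpha> n > 0"
    and "\<alpha> n \<le> 1/2"
    and "\<sigma> > 0"
    and "b > 1"
  shows "EC_capacity b n h \<alpha> \<sigma> =
    (SUP P\<in>{P. prob_space P \<and> sets P = sets borel \<and>
               measure_support P \<subseteq> {0..1} \<and>
               (\<integral>s. s \<partial>P) = (\<Sum>k=1..n. h k * \<alpha> k) \<and>
               (\<forall>k\<in>{1..n-1}. (\<integral>s. max (s - gain_sum h k) 0 \<partial>P)
                                \<le> (1 - gain_sum h k) * tail_mean n h \<alpha> k)}.
       ereal (gaussian_channel_information b \<sigma> (\<lambda>s. s) P))"
proof -
  let ?f = "\<lambda>x. \<Sum>k=1..n. h k * x k"
  have "EC_capacity b n h \<alpha> \<sigma> = (SUP P\<in>EC_input_laws n \<alpha>.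
      ereal (gaussian_channel_information b \<sigma> (\<lambda>s. s) (distr P borel ?f)))"
    unfolding EC_capacity_def
  proof (rule SUP_cong)
    fix P assume P: "P \<in> EC_input_laws n \<alpha>"
    then have [measurable_cong]: "sets P = sets (PiM {1..n} (\<lambda>_. borel))"
      by (simp add: EC_input_laws_def)
    have "?f \<in> borel_measurable P" by measurable
    then show "ereal (gaussian_channel_information b \<sigma> ?f P)
        = ereal (gaussian_channel_information b \<sigma> (\<lambda>s. s) (distr P borel ?f))"
      using P assms(8,9) by (simp add: EC_input_laws_def gaussian_channel_information_distr)
  qed simp
  \<comment> \<open>The objective now depends on the image law alone, so the supremum is reindexed
    along the image.\<close>
  also have "\<dots> = (SUP P\<in>sum_signal_laws n h \<alpha>. ereal (gaussian_channel_information b \<sigma> (\<lambda>s. s) P))"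
    using assms(5) by (subst distr_EC_input_laws[OF assms(2,3), symmetric])
      (auto simp: image_image less_imp_le)
  finally show ?thesis unfolding sum_signal_laws_def .
qed

end
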